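(* Let $V$ be a generalized space-time model with direct components $S$ and $T$. Assume that the normed space $S$ is strictly convex and smooth, that the s.i.p. of $S$ is continuously differentiable, and that the group of linear isometries of $H^+$ acts transitively on $H^+$. Let $d(\cdot,\cdot)$ denote the Minkowski-Finsler distance of $H^+$. Then $$[a,b]^+=-\cosh(d(a,b))\qquad\text{for all } a,b\in H^+.$$
   Context: **s.i.i.p.** A semi-indefinite-inner-product (s.i.i.p.) on a real vector space $V$ is a function $[\cdot,\cdot]:V\times V\to\mathbb R$ such that: (1) $[x+y,z]=[x,z]+[y,z]$; (2) $[\lambda x,y]=\lambda[x,y]$; (3) $[x,\lambda y]=\lambda[x,y]$ for all $\lambda\in\mathbb R$; (4) $[x,x]\in\mathbb R$; (5) if $[x,y]=0$ for all $y\in V$, or $[y,x]=0$ for all $y\in V$, then $x=0$; (6) $|[x,y]|^2\le[x,x][y,y]$ whenever $x,y$ lie in a common subspace on which $[z,z]\ge0$ for all $z$, or in a common subspace on which $[z,z]\le 0$ for all $z$. **Generalized space-time model.** Let $V$ be finite dimensional and real with an s.i.i.p., and $V=S\oplus T$ where $S$ is positive ($[s,s]>0$ for $0\ne s\in S$), $T$ is negative ($[t,t]<0$ for $0\neq t\in T$) and $\dim T=1$. The Minkowski product is $[s_1+t_1,s_2+t_2]^+=[s_1,s_2]+[t_1,t_2]$ ($s_i\in S$, $t_i\in T$). Fix $e_n\in T$ with $[e_n,e_n]=-1$. $S$ is a normed space with norm $\|s\|=\sqrt{[s,s]}$. Smooth means that the unit sphere has a unique supporting hyperplane at each of its points. **Continuously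 differentiable s.i.p.** For all $x,y,z\in S$ the limit $[x,\cdot]'_z(y)=\lim_{\lambda\to0}\frac{[x,y+\lambda z]-[x,y]}{\lambda}$ ($\lambda$ real) exists and, as a function of $y\neq0$, is continuous. **Upper sheet.** $H^+=\{s+\sqrt{1+[s,s]}\,e_n:s\in S\}$, the upper sheet of $H=\{v\in V:[v,v]^+=-1\}$. **Linear isometry.** A linear isometry of $H^+$ is the restriction to $H^+$ of a linear map $F:V\to V$ which preserves the Minkowski product ($[Fv,Fw]^+=[v,w]^+$ for all $v,w\in V$) and sends $H^+$ onto itself. **Minkowski-Finsler distance.** For $p,q\in H^+$ let $\Gamma_{p,q}$ be the set of piecewise differentiable curves $c:[a,b]\to H^+$ going from $p$ to $q$. Then $$d(p,q)=\inf\left\{\int_a^b\sqrt{[\dot c(x),\dot c(x)]^+}\,dx : c\in\Gamma_{p,q}\right\},$$ where $\dot c(x)$ is the tangent vector of $c$ at $c(x)$. *)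

theory Defs
  imports "HOL-Analysis.Analysis"
begin

text \<open>
  The ambient finite-dimensional real vector space is a type of class \<open>euclidean_space\<close>. Only its
  vector space structure and its (canonical) topology are used; its inner product and its norm
  play no role.
\<close>

text \<open>The axiom that \<open>[x,x]\<close> is real is part of the type of \<open>ip\<close>.\<close>

definition siip :: "('v::real_vector \<Rightarrow> 'v \<Rightarrow> real) \<Rightarrow> bool" where
  "siip ip \<longleftrightarrow>
     (\<forall>x y z. ip (x + y) z = ip x z + ip y z) \<and>
     (\<forall>r x y. ip (r *\<^sub>R x) y = r * ip x y) \<and>
     (\<forall>r x y. ip x (r *\<^sub>R y) = r * ip x y) \<and>
     (\<forall>x. (\<forall>y. ip x y = 0) \<or> (\<forall>y. ip y x = 0) \<longrightarrow> x = 0) \<and>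
     (\<forall>U x y. subspace U \<and> ((\<forall>z\<in>U. ip z z \<ge> 0) \<or> (\<forall>z\<in>U. ip z z \<le> 0)) \<and> x \<in> U \<and> y \<in> U
        \<longrightarrow> \<bar>ip x y\<bar>\<^sup>2 \<le> ip x x * ip y y)"

definition direct_sum_decomposition :: "'v::real_vector set \<Rightarrow> 'v set \<Rightarrow> bool" where
  "direct_sum_decomposition S T \<longleftrightarrow>
     subspace S \<and> subspace T \<and> S \<inter> T = {0} \<and> (\<forall>v. \<exists>s\<in>S. \<exists>t\<in>T. v = s + t)"

definition spacetime_model ::
    "('v::euclidean_space \<Rightarrow> 'v \<Rightarrow> real) \<Rightarrow> 'v set \<Rightarrow> 'v set \<Rightarrow> bool" where
  "spacetime_model ip S T \<longleftrightarrow>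
     siip ip \<and> direct_sum_decomposition S T \<and>
     (\<forall>s\<in>S. s \<noteq> 0 \<longrightarrow> ip s s > 0) \<and> (\<forall>t\<in>T. t \<noteq> 0 \<longrightarrow> ip t t < 0) \<and> dim T = 1"

text \<open>The component in \<open>A\<close> of a vector, with respect to the decomposition into \<open>A\<close> and \<open>B\<close>.\<close>

definition component :: "'v::real_vector set \<Rightarrow> 'v set \<Rightarrow> 'v \<Rightarrow> 'v" where
  "component A B v = (THE x. x \<in> A \<and> (\<exists>y\<in>B. v = x + y))"

definition mink_prod ::
    "('v::real_vector \<Rightarrow> 'v \<Rightarrow> real) \<Rightarrow> 'v set \<Rightarrow> 'v set \<Rightarrow> 'v \<Rightarrow> 'v \<Rightarrow> real" where
  "mink_prod ip S T v w =
     ip (component S T v) (component S T w) + ip (component T S v) (component T S w)"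

lemma component_add:
  assumes "direct_sum_decomposition A B" "x \<in> A" "y \<in> B"
  shows "component A B (x + y) = x"
  unfolding component_def
proof (rule the_equality)
  show "x \<in> A \<and> (\<exists>y'\<in>B. x + y = x + y')"
    using assms by blast
next
  fix x' assume "x' \<in> A \<and> (\<exists>y'\<in>B. x + y = x' + y')"
  then obtain y' where x': "x' \<in> A" "y' \<in> B" "x + y = x' + y'" by blast
  have "x' - x = y - y'" using x'(3) by (simp add: algebra_simps)
  moreover have "x' - x \<in> A" "y - y' \<in> B"
    using assms x' by (auto simp: direct_sum_decomposition_def intro: subspace_diff)
  ultimately have "x' - x \<in> A \<inter> B" by simp
  then have "x' - x = 0" using assms unfolding direct_sum_decomposition_def by blast
  then show "x' = x" by simp
qed

lemma direct_sum_decomposition_commute: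
  "direct_sum_decomposition A B \<Longrightarrow> direct_sum_decomposition B A"
  unfolding direct_sum_decomposition_def by (metis Int_commute add.commute)

lemma mink_prod_eq:
  assumes "direct_sum_decomposition S T" "s1 \<in> S" "s2 \<in> S" "t1 \<in> T" "t2 \<in> T"
  shows "mink_prod ip S T (s1 + t1) (s2 + t2) = ip s1 s2 + ip t1 t2"
proof -
  note d = assms(1) direct_sum_decomposition_commute[OF assms(1)]
  have "component T S (s1 + t1) = t1" "component T S (s2 + t2) = t2"
    using component_add[OF d(2), of t1 s1] component_add[OF d(2), of t2 s2] assms
    by (simp_all add: add.commute)
  then show ?thesis
    using assms by (simp add: mink_prod_def component_add)
qed

definition ip_norm :: "('v::real_vector \<Rightarrow> 'v \<Rightarrow> real) \<Rightarrow> 'v \<Rightarrow> real" where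
  "ip_norm ip s = sqrt (ip s s)"

definition unit_sphere :: "('v::real_vector \<Rightarrow> 'v \<Rightarrow> real) \<Rightarrow> 'v set \<Rightarrow> 'v set" where
  "unit_sphere ip S = {s\<in>S. ip_norm ip s = 1}"

text \<open>Strict convexity: the unit sphere contains no nondegenerate segment.\<close>

definition strictly_convex_space :: "('v::real_vector \<Rightarrow> 'v \<Rightarrow> real) \<Rightarrow> 'v set \<Rightarrow> bool" where
  "strictly_convex_space ip S \<longleftrightarrow>
     (\<forall>x\<in>unit_sphere ip S. \<forall>y\<in>unit_sphere ip S.
        closed_segment x y \<subseteq> unit_sphere ip S \<longrightarrow> x = y)"

text \<open>
  Hyperplanes are hyperplanes of the space \<open>S\<close>, not of the ambient space, and are taken as sets so
  that uniqueness is not affected by rescaling the equation.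
\<close>

definition supporting_hyperplane ::
    "('v::real_vector \<Rightarrow> 'v \<Rightarrow> real) \<Rightarrow> 'v set \<Rightarrow> 'v \<Rightarrow> 'v set \<Rightarrow> bool" where
  "supporting_hyperplane ip S u P \<longleftrightarrow>
     (\<exists>f c. linear f \<and> (\<exists>s\<in>S. f s \<noteq> (0::real)) \<and> P = {s\<in>S. f s = c} \<and> u \<in> P \<and>
        (\<forall>s\<in>unit_sphere ip S. f s \<le> c))"

definition smooth_space :: "('v::real_vector \<Rightarrow> 'v \<Rightarrow> real) \<Rightarrow> 'v set \<Rightarrow> bool" where
  "smooth_space ip S \<longleftrightarrow> (\<forall>u\<in>unit_sphere ip S. \<exists>!P. supporting_hyperplane ip S u P)"

definition diff_quot :: "('v::real_vector \<Rightarrow> 'v \<Rightarrow> real) \<Rightarrow> 'v \<Rightarrow> 'v \<Rightarrow> 'v \<Rightarrow> real \<Rightarrow> real" where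
  "diff_quot ip x z y l = (ip x (y + l *\<^sub>R z) - ip x y) / l"

definition sip_deriv :: "('v::real_vector \<Rightarrow> 'v \<Rightarrow> real) \<Rightarrow> 'v \<Rightarrow> 'v \<Rightarrow> 'v \<Rightarrow> real" where
  "sip_deriv ip x z y = Lim (at 0) (diff_quot ip x z y)"

definition continuously_differentiable_sip ::
    "('v::euclidean_space \<Rightarrow> 'v \<Rightarrow> real) \<Rightarrow> 'v set \<Rightarrow> bool" where
  "continuously_differentiable_sip ip S \<longleftrightarrow>
     (\<forall>x\<in>S. \<forall>y\<in>S. \<forall>z\<in>S. \<exists>L. (diff_quot ip x z y \<longlongrightarrow> L) (at 0)) \<and>
     (\<forall>x\<in>S. \<forall>z\<in>S. continuous_on (S - {0}) (sip_deriv ip x z))"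

definition upper_sheet :: "('v::real_vector \<Rightarrow> 'v \<Rightarrow> real) \<Rightarrow> 'v set \<Rightarrow> 'v \<Rightarrow> 'v set" where
  "upper_sheet ip S e = {s + sqrt (1 + ip s s) *\<^sub>R e | s. s \<in> S}"

definition linear_isometries ::
    "('v::real_vector \<Rightarrow> 'v \<Rightarrow> real) \<Rightarrow> 'v set \<Rightarrow> 'v set \<Rightarrow> 'v \<Rightarrow> ('v \<Rightarrow> 'v) set" where
  "linear_isometries ip S T e =
     {restrict F (upper_sheet ip S e) | F. linear F \<and>
        (\<forall>v w. mink_prod ip S T (F v) (F w) = mink_prod ip S T v w) \<and>
        F ` upper_sheet ip S e = upper_sheet ip S e}"

definition acts_transitively :: "('a \<Rightarrow> 'a) set \<Rightarrow> 'a set \<Rightarrow> bool" where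
  "acts_transitively G X \<longleftrightarrow> (\<forall>p\<in>X. \<forall>q\<in>X. \<exists>g\<in>G. g p = q)"

definition curves ::
    "('v::euclidean_space \<Rightarrow> 'v \<Rightarrow> real) \<Rightarrow> 'v set \<Rightarrow> 'v \<Rightarrow> 'v \<Rightarrow> 'v \<Rightarrow>
       (real \<times> real \<times> (real \<Rightarrow> 'v)) set" where
  "curves ip S e p q =
     {(a, b, c). a < b \<and> c piecewise_differentiable_on {a..b} \<and>
        c ` {a..b} \<subseteq> upper_sheet ip S e \<and> c a = p \<and> c b = q}"

text \<open>
  The speed of a piecewise differentiable curve need not be integrable, so lengths are taken in
  \<open>[0,\<infinity>]\<close>: a curve of infinite length contributes \<open>\<infinity>\<close> to the infimum, whereas
  a real-valued integral would give it the junk value 0. The finitely many parameters at which the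
  curve is not differentiable form a null set; elsewhere the velocity is tangent to the upper sheet,
  where \<open>[v,v]\<close> is nonnegative if the norm of \<open>S\<close> is smooth with continuously differentiable
  product, so \<open>ennreal\<close> cuts nothing off.
\<close>

definition curve_length ::
    "('v::euclidean_space \<Rightarrow> 'v \<Rightarrow> real) \<Rightarrow> 'v set \<Rightarrow> 'v set \<Rightarrow> real \<Rightarrow> real \<Rightarrow> (real \<Rightarrow> 'v) \<Rightarrow> ennreal"
  where
  "curve_length ip S T a b c =
     (\<integral>\<^sup>+x\<in>{a..b}. ennreal (sqrt (mink_prod ip S T
        (vector_derivative c (at x within {a..b})) (vector_derivative c (at x within {a..b}))))
      \<partial>lborel)"

definition mf_dist ::
    "('v::euclidean_space \<Rightarrow> 'v \<Rightarrow> real) \<Rightarrow> 'v set \<Rightarrow> 'v set \<Rightarrow> 'v \<Rightarrow> 'v \<Rightarrow> 'v \<Rightarrow> real" where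
  "mf_dist ip S T e p q =
     enn2real (INF (a, b, c)\<in>curves ip S e p q. curve_length ip S T a b c)"

end

theory Submission
  imports Defs
begin

text \<open>
  A point of the upper sheet has a space part \<open>s\<close> and a height \<open>\<tau> = sqrt (1 + [s,s]) \<ge> 1\<close>, and
  \<open>[e,b]\<^sup>+\<close> is minus the height of \<open>b\<close>. So for \<open>a = e\<close> the claim is that the distance from
  \<open>e\<close> to \<open>b\<close> is \<open>arcosh \<tau>\<close>. The hyperbola through \<open>e\<close> and \<open>b\<close> in the plane that they span
  has exactly this length (\<open>hyperbola_to_point\<close>).

  No curve is shorter. Along a curve \<open>c\<close> on the sheet, Cauchy-Schwarz says that
  \<open>[s(y), s(x)] \<le> \<parallel>s(y)\<parallel> \<parallel>s(x)\<parallel>\<close>, with equality at \<open>y = x\<close>. The left side is linear in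
  \<open>s(y)\<close>, and the right side is, for heights above \<open>1\<close>, a differentiable function of the height of
  \<open>c y\<close>; so both have the same derivative at \<open>y = x\<close>, which says that the velocity is Minkowski orthogonal to the
  position (\<open>velocity_orthogonal\<close>). A second use of Cauchy-Schwarz bounds the speed below by the rate
  of change of \<open>arcosh \<tau>\<close> (\<open>speed_ge_height_change\<close>), and integration gives the bound on the length
  (\<open>arcosh_height_le_curve_length\<close>).

  For a general \<open>a\<close>, transitivity provides isometries \<open>F\<close> with \<open>F a = e\<close> and \<open>G\<close> with
  \<open>G e = a\<close>. An isometry does not increase distances, so \<open>F\<close> carries the lower bound from \<open>e\<close> to \<open>a\<close>
  and \<open>G\<close> carries the upper bound (\<open>dist_eq_arcosh\<close>).
\<close>

section \<open>Increments and integrals of bounds on the derivative\<close>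

text \<open>
  The speed of a curve is not known to be measurable or integrable, so \<open>g\<close> is arbitrary here. The
  derivative \<open>f'\<close> is Henstock-Kurzweil integrable with integral \<open>f b - f a\<close>, hence Lebesgue
  measurable. Either the integral of \<open>\<bar>f'\<bar>\<close> is infinite, or \<open>f'\<close> is Lebesgue integrable
  with the same integral. Passing from \<open>\<bar>f'\<bar>\<close> to \<open>g\<close> is monotonicity.
\<close>

lemma ennreal_diff_le_nn_integral_bound_deriv:
  fixes f f' g :: "real \<Rightarrow> real"
  assumes "a \<le> b" "finite K" "continuous_on {a..b} f"
    and deriv: "\<And>x. x \<in> {a<..<b} - K \<Longrightarrow> (f has_vector_derivative f' x) (at x)"
    and bound: "\<And>x. x \<in> {a<..<b} - K \<Longrightarrow> \<bar>f' x\<bar> \<le> g x"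
  shows "ennreal (f b - f a) \<le> (\<integral>\<^sup>+x\<in>{a..b}. ennreal (g x) \<partial>lborel)"
proof -
  define D where "D = (\<lambda>x. f' x * indicator {a..b} x)"
  have ftc: "(f' has_integral (f b - f a)) {a..b}"
    by (rule fundamental_theorem_of_calculus_interior_strong[OF assms(2,1) deriv assms(3)])
  have D_meas: "D \<in> borel_measurable lebesgue"
    unfolding D_def using has_integral_implies_lebesgue_measurable_real[OF ftc] .
  have le_D: "ennreal (f b - f a) \<le> (\<integral>\<^sup>+x. ennreal (norm (D x)) \<partial>lebesgue)"
  proof (cases "(\<integral>\<^sup>+x. ennreal (norm (D x)) \<partial>lebesgue) < \<infinity>")
    case True
    then have int: "integrable lebesgue D"
      using D_meas by (intro integrableI_bounded) auto
    have "(\<lambda>x. f' x * indicator {a..b} x) = (\<lambda>x. if x \<in> {a..b} then f' x else 0)"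
      by auto
    then have "(f' has_integral (integral\<^sup>L lebesgue D)) {a..b}"
      using has_integral_integral_lebesgue[OF int] has_integral_restrict_UNIV[of "{a..b}" f']
      by (simp add: D_def)
    then have "f b - f a = integral\<^sup>L lebesgue D"
      using ftc has_integral_unique by blast
    then have "ennreal (f b - f a) \<le> ennreal (norm (integral\<^sup>L lebesgue D))"
      by (simp add: ennreal_leI)
    then show ?thesis
      using integral_norm_bound_ennreal[OF int] by (rule order_trans)
  next
    case False
    then show ?thesis by (simp add: less_top[symmetric] not_less top_unique)
  qed
  have "AE x in lborel. x \<notin> K \<union> {a, b}"
    using \<open>finite K\<close> by (intro AE_not_in finite_imp_null_set_lborel) auto
  then have "AE x in lborel. ennreal (norm (D x)) \<le> ennreal (g x) * indicator {a..b} x"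
  proof eventually_elim
    case (elim x)
    show ?case
    proof (cases "x \<in> {a..b}")
      case True
      then have "x \<in> {a<..<b} - K" using elim by auto
      with bound[of x] True show ?thesis by (simp add: D_def ennreal_leI)
    qed (simp add: D_def)
  qed
  then have "(\<integral>\<^sup>+x. ennreal (norm (D x)) \<partial>lborel) \<le> (\<integral>\<^sup>+x\<in>{a..b}. ennreal (g x) \<partial>lborel)"
    by (rule nn_integral_mono_AE)
  with le_D show ?thesis by (simp add: nn_integral_completion)
qed

section \<open>Coordinates in a space-time model\<close>

locale minkowski_model =
  fixes ip :: "'v::euclidean_space \<Rightarrow> 'v \<Rightarrow> real" and S T :: "'v set" and e :: 'v
  assumes model: "spacetime_model ip S T"
    and e_in_T: "e \<in> T" and ip_e_e: "ip e e = -1"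
begin

lemma ip_add_left: "ip (x + y) z = ip x z + ip y z"
  and ip_scale_left: "ip (r *\<^sub>R x) y = r * ip x y"
  and ip_scale_right: "ip x (r *\<^sub>R y) = r * ip x y"
  using model by (auto simp: spacetime_model_def siip_def)

lemma ip_zero_right [simp]: "ip x 0 = 0"
  using ip_scale_right[of x 0 0] by simp

lemma linear_ip_left: "linear (\<lambda>x. ip x y)"
  by (rule linearI) (simp_all add: ip_add_left ip_scale_left)

lemma decomp: "direct_sum_decomposition S T"
  using model by (simp add: spacetime_model_def)

lemma subspace_S: "subspace S"
  using decomp by (simp add: direct_sum_decomposition_def)

lemma ip_nonneg: "s \<in> S \<Longrightarrow> 0 \<le> ip s s"
  using model by (cases "s = 0") (auto simp: spacetime_model_def less_imp_le)

lemma ip_pos: "s \<in> S \<Longrightarrow> s \<noteq> 0 \<Longrightarrow> 0 < ip s s"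
  using model by (auto simp: spacetime_model_def)

lemma cauchy_schwarz_S:
  assumes "x \<in> S" "y \<in> S"
  shows "\<bar>ip x y\<bar> \<le> sqrt (ip x x) * sqrt (ip y y)"
proof -
  have *: "\<forall>U x y. subspace U \<and> ((\<forall>z\<in>U. ip z z \<ge> 0) \<or> (\<forall>z\<in>U. ip z z \<le> 0)) \<and> x \<in> U \<and> y \<in> U
        \<longrightarrow> \<bar>ip x y\<bar>\<^sup>2 \<le> ip x x * ip y y"
    using model unfolding spacetime_model_def siip_def by blast
  have "\<bar>ip x y\<bar>\<^sup>2 \<le> ip x x * ip y y"
    using *[rule_format, of S x y] subspace_S ip_nonneg assms by blast
  then have "sqrt (\<bar>ip x y\<bar>\<^sup>2) \<le> sqrt (ip x x * ip y y)"
    by (rule real_sqrt_le_mono)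
  then show ?thesis by (simp add: real_sqrt_mult)
qed

lemma T_eq_span: "T = span {e}"
proof -
  have "e \<noteq> 0" using ip_e_e by auto
  then have "dim (span {e}) = 1" by (simp add: dim_eq_card_independent)
  moreover have "dim T = 1" "subspace T" using model decomp
    by (simp_all add: spacetime_model_def direct_sum_decomposition_def)
  moreover have "span {e} \<subseteq> T"
    using \<open>subspace T\<close> e_in_T by (intro span_minimal) auto
  ultimately show ?thesis
    using subspace_dim_equal[of "span {e}" T] by simp
qed

abbreviation space_part :: "'v \<Rightarrow> 'v" where
  "space_part \<equiv> component S T"

text \<open>The coefficient of \<open>e\<close> in \<open>v\<close>; the sign comes from \<open>ip e e = -1\<close>.\<close>

definition height :: "'v \<Rightarrow> real" where
  "height v = - ip (component T S v) e"

lemma obtain_decomposition: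
  obtains s where "s \<in> S" "v = s + height v *\<^sub>R e" "space_part v = s"
proof -
  obtain s t where st: "s \<in> S" "t \<in> T" "v = s + t"
    using decomp unfolding direct_sum_decomposition_def by blast
  then obtain k where k: "t = k *\<^sub>R e" using T_eq_span by (auto simp: span_singleton)
  have "component T S v = t"
    using component_add[OF direct_sum_decomposition_commute[OF decomp], of t s] st
    by (simp add: add.commute)
  then have "height v = k" by (simp add: height_def k ip_scale_left ip_e_e)
  moreover have "space_part v = s" using component_add[OF decomp] st by simp
  ultimately show ?thesis using that st k by blast
qed

lemma space_part_in_S [simp]: "space_part v \<in> S"
  by (metis obtain_decomposition)

lemma decompose: "v = space_part v + height v *\<^sub>R e"
  by (metis obtain_decomposition)

lemma scale_e_in_T: "k *\<^sub>R e \<in> T"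
  by (simp add: T_eq_span span_base span_scale)

lemma space_part_eq [simp]: "s \<in> S \<Longrightarrow> space_part (s + k *\<^sub>R e) = s"
  by (rule component_add[OF decomp _ scale_e_in_T])

lemma height_eq [simp]: "s \<in> S \<Longrightarrow> height (s + k *\<^sub>R e) = k"
  using component_add[OF direct_sum_decomposition_commute[OF decomp] scale_e_in_T, of s k]
  by (simp add: height_def add.commute ip_scale_left ip_e_e)

lemma linear_space_part: "linear space_part"
proof (rule linearI)
  fix v w :: 'v and r :: real
  have "v + w = (space_part v + space_part w) + (height v + height w) *\<^sub>R e"
    using decompose[of v] decompose[of w] by (simp add: algebra_simps)
  then show "space_part (v + w) = space_part v + space_part w"
    by (metis space_part_eq space_part_in_S subspace_S subspace_add)
  have "r *\<^sub>R v = r *\<^sub>R space_part v + (r * height v) *\<^sub>R e"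
    using decompose[of v] by (metis scaleR_add_right scaleR_scaleR)
  then show "space_part (r *\<^sub>R v) = r *\<^sub>R space_part v"
    by (metis space_part_eq space_part_in_S subspace_S subspace_scale)
qed

lemma linear_height: "linear height"
proof (rule linearI)
  fix v w :: 'v and r :: real
  have "v + w = (space_part v + space_part w) + (height v + height w) *\<^sub>R e"
    using decompose[of v] decompose[of w] by (simp add: algebra_simps)
  then show "height (v + w) = height v + height w"
    by (metis height_eq space_part_in_S subspace_S subspace_add)
  have "r *\<^sub>R v = r *\<^sub>R space_part v + (r * height v) *\<^sub>R e"
    using decompose[of v] by (metis scaleR_add_right scaleR_scaleR)
  then show "height (r *\<^sub>R v) = r *\<^sub>R height v"
    by (metis height_eq space_part_in_S subspace_S subspace_scale real_scaleR_def)
qed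

lemma mink_prod_height:
  "mink_prod ip S T v w = ip (space_part v) (space_part w) - height v * height w"
proof -
  have "mink_prod ip S T v w =
      mink_prod ip S T (space_part v + height v *\<^sub>R e) (space_part w + height w *\<^sub>R e)"
    using decompose by simp
  also have "\<dots> = ip (space_part v) (space_part w) + ip (height v *\<^sub>R e) (height w *\<^sub>R e)"
    by (rule mink_prod_eq[OF decomp]) (simp_all add: scale_e_in_T)
  finally show ?thesis by (simp add: ip_scale_left ip_scale_right ip_e_e)
qed

abbreviation sheet :: "'v set" where
  "sheet \<equiv> upper_sheet ip S e"

lemma in_sheet_iff: "v \<in> sheet \<longleftrightarrow> height v = sqrt (1 + ip (space_part v) (space_part v))"
proof
  show "v \<in> sheet \<Longrightarrow> height v = sqrt (1 + ip (space_part v) (space_part v))"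
    by (auto simp: upper_sheet_def)
  show "height v = sqrt (1 + ip (space_part v) (space_part v)) \<Longrightarrow> v \<in> sheet"
    unfolding upper_sheet_def using decompose[of v] by auto
qed

lemma sheet_height_ge_1: "v \<in> sheet \<Longrightarrow> 1 \<le> height v"
  by (simp add: in_sheet_iff ip_nonneg)

lemma sheet_ip_space_part:
  assumes "v \<in> sheet"
  shows "ip (space_part v) (space_part v) = (height v)\<^sup>2 - 1"
  using assms ip_nonneg[of "space_part v"] by (simp add: in_sheet_iff)

lemma space_part_e [simp]: "space_part e = 0" and height_e [simp]: "height e = 1"
  using space_part_eq[of 0 1] height_eq[of 0 1] subspace_S by (simp_all add: subspace_0)

lemma e_in_sheet: "e \<in> sheet"
  by (simp add: in_sheet_iff)

lemma mink_prod_e_left: "mink_prod ip S T e v = - height v"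
  using linear_0[OF linear_ip_left] by (simp add: mink_prod_height)

section \<open>The distance from the vertex\<close>

text \<open>
  This is \<open>[v, c x]\<^sup>+ = 0\<close>. By Cauchy-Schwarz the function \<open>\<phi>\<close> below has a maximum at \<open>x\<close>, and it
  involves \<open>c y\<close> only through linear functions and the height. The assumption on the height keeps the
  norm \<open>sqrt (h\<^sup>2 - 1)\<close> of the space part away from \<open>0\<close>, where the root is not differentiable.
\<close>

lemma velocity_orthogonal:
  assumes c: "(c has_vector_derivative v) (at x)"
    and on_sheet: "x \<in> {a<..<b}" "c ` {a<..<b} \<subseteq> sheet"
    and above: "1 < height (c x)"
  shows "ip (space_part v) (space_part (c x)) = height v * height (c x)"
proof -
  define h where "h = (\<lambda>y. height (c y))"
  define r where "r = (\<lambda>y. sqrt ((h y)\<^sup>2 - 1))"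
  define \<phi> where "\<phi> = (\<lambda>y. ip (space_part (c y)) (space_part (c x)) - r y * r x)"
  have hx: "1 < h x" using above by (simp add: h_def)
  then have "1 < (h x)\<^sup>2" by (simp add: one_less_power)
  then have r_pos: "0 < r x" by (simp add: r_def)
  have h': "(h has_real_derivative height v) (at x)"
    unfolding h_def has_real_derivative_iff_has_vector_derivative
    by (rule bounded_linear.has_vector_derivative[OF linear_conv_bounded_linear[THEN iffD1] c])
      (rule linear_height)
  have lin: "((\<lambda>y. ip (space_part (c y)) (space_part (c x))) has_real_derivative
      ip (space_part v) (space_part (c x))) (at x)"
    unfolding has_real_derivative_iff_has_vector_derivative
    by (rule bounded_linear.has_vector_derivative[OF linear_conv_bounded_linear[THEN iffD1] c])
      (rule linear_compose[OF linear_space_part linear_ip_left, unfolded o_def])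
  have r': "(r has_real_derivative height v * h x / r x) (at x)"
    unfolding r_def using \<open>1 < (h x)\<^sup>2\<close>
    by (auto intro!: derivative_eq_intros h' simp: divide_simps)
  have \<phi>': "(\<phi> has_real_derivative ip (space_part v) (space_part (c x)) - height v * h x) (at x)"
    unfolding \<phi>_def using r_pos
    by (auto intro!: derivative_eq_intros lin r')
  have norm_eq: "sqrt (ip (space_part (c y)) (space_part (c y))) = r y" if "y \<in> {a<..<b}" for y
  proof -
    have "c y \<in> sheet" using that on_sheet(2) by blast
    then show ?thesis by (simp add: r_def h_def sheet_ip_space_part)
  qed
  have le0: "\<phi> y \<le> 0" if "y \<in> {a<..<b}" for y
    using cauchy_schwarz_S[of "space_part (c y)" "space_part (c x)"] norm_eq that on_sheet(1)
    by (simp add: \<phi>_def)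
  have "c x \<in> sheet" using on_sheet by auto
  then have "\<phi> x = 0"
    using hx sheet_ip_space_part[of "c x"] by (simp add: \<phi>_def r_def h_def)
  then have "\<forall>y. \<bar>x - y\<bar> < min (x - a) (b - x) \<longrightarrow> \<phi> y \<le> \<phi> x"
    using le0 by (auto simp: abs_if split: if_splits)
  then have "ip (space_part v) (space_part (c x)) - height v * h x = 0"
    using DERIV_local_max[OF \<phi>', of "min (x - a) (b - x)"] on_sheet(1) by auto
  then show ?thesis by (simp add: h_def)
qed

text \<open>
  The left side is the absolute value of the derivative of \<open>arcosh (height (c y))\<close> at \<open>y = x\<close>.
  With \<open>k\<close> the height of \<open>v\<close> and \<open>m\<close> the square of the norm of its space part, orthogonality and
  Cauchy-Schwarz give \<open>(k h)\<^sup>2 \<le> m (h\<^sup>2 - 1)\<close>, which is \<open>k\<^sup>2 / (h\<^sup>2 - 1) \<le> m - k\<^sup>2\<close>.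
\<close>

lemma speed_ge_height_change:
  assumes c: "(c has_vector_derivative v) (at x)"
    and on_sheet: "x \<in> {a<..<b}" "c ` {a<..<b} \<subseteq> sheet"
    and above: "1 < height (c x)"
  shows "\<bar>height v / sqrt ((height (c x))\<^sup>2 - 1)\<bar> \<le> sqrt (mink_prod ip S T v v)"
proof -
  define h where "h = height (c x)"
  define k where "k = height v"
  define m where "m = ip (space_part v) (space_part v)"
  have h: "1 < h\<^sup>2" using above by (simp add: h_def)
  have m: "0 \<le> m" by (simp add: m_def ip_nonneg)
  have "c x \<in> sheet" using on_sheet by auto
  then have "\<bar>k * h\<bar> \<le> sqrt m * sqrt (h\<^sup>2 - 1)"
    using cauchy_schwarz_S[of "space_part v" "space_part (c x)"] velocity_orthogonal[OF assms]
    by (simp add: h_def k_def m_def sheet_ip_space_part)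
  then have "(k * h)\<^sup>2 \<le> (sqrt m * sqrt (h\<^sup>2 - 1))\<^sup>2"
    by (metis abs_ge_zero power2_abs power_mono)
  also have "\<dots> = m * (h\<^sup>2 - 1)"
    using m h by (simp add: power_mult_distrib)
  finally have "k\<^sup>2 / (h\<^sup>2 - 1) \<le> m - k\<^sup>2"
    using h by (simp add: divide_simps power_mult_distrib algebra_simps)
  then have "sqrt (k\<^sup>2 / (h\<^sup>2 - 1)) \<le> sqrt (m - k\<^sup>2)"
    by (rule real_sqrt_le_mono)
  then show ?thesis
    using h by (simp add: mink_prod_height real_sqrt_divide h_def k_def m_def power2_eq_square)
qed

text \<open>
  Since \<open>arcosh\<close> is not differentiable at \<open>1\<close>, only the part of the curve after its last visit to
  \<open>e\<close>, the point of height \<open>1\<close>, is used.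
\<close>

lemma arcosh_height_le_curve_length:
  assumes "(a, b, c) \<in> curves ip S e e q"
  shows "ennreal (arcosh (height q)) \<le> curve_length ip S T a b c"
proof -
  from assms have ab: "a < b" and sub: "c ` {a..b} \<subseteq> sheet" and ends: "c a = e" "c b = q"
    and pd: "c piecewise_differentiable_on {a..b}"
    by (auto simp: curves_def)
  obtain K where cont: "continuous_on {a..b} c" and K: "finite K"
    and diff: "\<And>x. x \<in> {a..b} - K \<Longrightarrow> c differentiable (at x within {a..b})"
    using pd unfolding piecewise_differentiable_on_def by blast
  define h where "h = (\<lambda>x. height (c x))"
  have contH: "continuous_on {a..b} h"
    unfolding h_def by (rule linear_continuous_on_compose[OF cont linear_height])
  have h1: "1 \<le> h x" if "x \<in> {a..b}" for x
    unfolding h_def using that sub by (intro sheet_height_ge_1) auto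
  define Z where "Z = {x \<in> {a..b}. h x = 1}"
  have "compact Z"
    using continuous_closed_preimage[OF contH, of "{1}"]
    unfolding Z_def compact_eq_bounded_closed
    by (auto simp: vimage_def Int_def intro: bounded_subset[of "{a..b}"])
  moreover have "a \<in> Z" using ab ends by (simp add: Z_def h_def)
  ultimately obtain t where t: "t \<in> Z" "\<And>x. x \<in> Z \<Longrightarrow> x \<le> t"
    using compact_attains_sup[of Z] by blast
  have tab: "a \<le> t" "t \<le> b" "h t = 1" using t(1) by (auto simp: Z_def)
  have above: "1 < h x" if "x \<in> {t<..b}" for x
    using h1[of x] t(2)[of x] that tab by (force simp: Z_def)
  define V where "V = (\<lambda>x. vector_derivative c (at x within {a..b}))"
  have V: "(c has_vector_derivative V x) (at x)" if "x \<in> {t<..<b} - K" for x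
  proof -
    have x: "x \<in> {a..b} - K" "x \<in> {a<..<b}" using that tab by auto
    then have "(c has_vector_derivative V x) (at x within {a..b})"
      using diff[OF x(1)] vector_derivative_works by (auto simp: V_def)
    then have "(c has_vector_derivative V x) (at x within {a<..<b})"
      by (rule has_vector_derivative_within_subset) auto
    then show ?thesis
      using x(2) by (simp only: at_within_open[OF _ open_greaterThanLessThan])
  qed
  have "ennreal (arcosh (h b) - arcosh (h t))
      \<le> (\<integral>\<^sup>+x\<in>{t..b}. ennreal (sqrt (mink_prod ip S T (V x) (V x))) \<partial>lborel)"
  proof (rule ennreal_diff_le_nn_integral_bound_deriv[OF tab(2) K])
    show "continuous_on {t..b} (\<lambda>x. arcosh (h x))"
      using tab h1 by (intro continuous_on_arcosh' continuous_on_subset[OF contH]) auto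
    fix x assume x: "x \<in> {t<..<b} - K"
    then have hx: "1 < h x" using above by auto
    have h': "(h has_real_derivative height (V x)) (at x)"
      unfolding h_def has_real_derivative_iff_has_vector_derivative
      by (rule bounded_linear.has_vector_derivative[OF linear_conv_bounded_linear[THEN iffD1] V[OF x]])
        (rule linear_height)
    have "((\<lambda>x. arcosh (h x)) has_real_derivative 
        1 / sqrt ((h x)\<^sup>2 - 1) * height (V x)) (at x)"
      by (rule DERIV_chain2[OF arcosh_real_has_field_derivative h']) (rule hx)
    then show "((\<lambda>x. arcosh (h x)) has_vector_derivative height (V x) / sqrt ((h x)\<^sup>2 - 1)) (at x)"
      by (simp add: has_real_derivative_iff_has_vector_derivative)
    show "\<bar>height (V x) / sqrt ((h x)\<^sup>2 - 1)\<bar> \<le> sqrt (mink_prod ip S T (V x) (V x))"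
      unfolding h_def
    proof (rule speed_ge_height_change[OF V[OF x]])
      show "x \<in> {a<..<b}" "c ` {a<..<b} \<subseteq> sheet" using x tab sub by auto
      show "1 < height (c x)" using hx by (simp add: h_def)
    qed
  qed
  also have "\<dots> \<le> (\<integral>\<^sup>+x\<in>{a..b}. ennreal (sqrt (mink_prod ip S T (V x) (V x))) \<partial>lborel)"
    using tab by (intro nn_integral_mono) (auto simp: indicator_def)
  finally show ?thesis
    using tab ends by (simp add: curve_length_def V_def h_def)
qed

lemma hyperbola_to_point:
  assumes q: "q \<in> sheet"
  obtains c where "(0, 1, c) \<in> curves ip S e e q"
    and "curve_length ip S T 0 1 c = ennreal (arcosh (height q))"
proof -
  define R where "R = arcosh (height q)"
  define r where "r = sqrt (ip (space_part q) (space_part q))"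
  define u where "u = space_part q /\<^sub>R r"
  define c where "c = (\<lambda>t. sinh (t * R) *\<^sub>R u + cosh (t * R) *\<^sub>R e)"
  define V where "V = (\<lambda>t. (R * cosh (t * R)) *\<^sub>R u + (R * sinh (t * R)) *\<^sub>R e)"
  have hq: "1 \<le> height q" using sheet_height_ge_1[OF q] .
  have R: "0 \<le> R" "cosh R = height q" "sinh R = r"
    using hq by (simp_all add: R_def r_def sinh_arcosh_real sheet_ip_space_part[OF q])
  have uS: "u \<in> S" by (simp add: u_def subspace_S subspace_scale)
  have scaled_in_S: "k *\<^sub>R u \<in> S" for k using uS subspace_S by (simp add: subspace_scale)
  \<comment> \<open>If \<open>q = e\<close> then \<open>u = 0\<close>, and the curve is constant because \<open>R = 0\<close>.\<close>
  have unit: "R = 0 \<or> ip u u = 1"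
  proof (cases "space_part q = 0")
    case True
    then have "r = 0" by (simp add: r_def)
    then show ?thesis using R(3) by simp
  next
    case False
    then have "0 < ip (space_part q) (space_part q)" by (simp add: ip_pos)
    then show ?thesis by (simp add: u_def r_def ip_scale_left ip_scale_right field_simps)
  qed
  have q_eq: "r *\<^sub>R u = space_part q"
    using ip_pos[of "space_part q"] by (cases "space_part q = 0") (auto simp: u_def r_def)
  have c': "(c has_vector_derivative V t) (at t within A)" for t A
    unfolding c_def V_def
    by (auto intro!: derivative_eq_intros simp: mult.commute)
  have on_sheet: "c t \<in> sheet" for t
  proof -
    have "(cosh (t * R))\<^sup>2 = 1 + sinh (t * R) * (sinh (t * R) * ip u u)"
    proof (rule disjE[OF unit])
      assume "ip u u = 1"
      then show ?thesis using cosh_square_eq[of "t * R"] by (simp add: power2_eq_square)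
    qed simp
    then have "sqrt (1 + sinh (t * R) * (sinh (t * R) * ip u u)) = cosh (t * R)"
      by (metis cosh_real_nonneg real_sqrt_unique)
    then show ?thesis
      by (simp add: in_sheet_iff c_def scaled_in_S ip_scale_left ip_scale_right)
  qed
  have speed: "mink_prod ip S T (V t) (V t) = R\<^sup>2" for t
  proof -
    have "mink_prod ip S T (V t) (V t) = R\<^sup>2 * ((cosh (t * R))\<^sup>2 * ip u u - (sinh (t * R))\<^sup>2)"
      by (simp add: V_def mink_prod_height scaled_in_S ip_scale_left ip_scale_right
          algebra_simps power2_eq_square)
    then show ?thesis using unit by (auto simp: cosh_square_eq)
  qed
  have "(0, 1, c) \<in> curves ip S e e q"
  proof -
    have "c differentiable_on {0..1}"
      unfolding differentiable_on_def
      using c' by (blast intro: differentiableI_vector)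
    moreover have "c 1 = q" using R q_eq decompose[of q] by (simp add: c_def)
    moreover have "c 0 = e" by (simp add: c_def)
    ultimately show ?thesis
      using on_sheet by (auto simp: curves_def differentiable_on_imp_piecewise_differentiable)
  qed
  moreover have "curve_length ip S T 0 1 c = ennreal R"
  proof -
    have "vector_derivative c (at t within {0..1}) = V t" if "t \<in> {0..1}" for t
      using that c' by (intro vector_derivative_within_closed_interval) auto
    then have "curve_length ip S T 0 1 c = (\<integral>\<^sup>+t\<in>{0..1::real}. ennreal R \<partial>lborel)"
      unfolding curve_length_def
      by (intro set_nn_integral_cong) (simp_all add: speed R(1))
    then show ?thesis by (simp add: nn_integral_cmult_indicator)
  qed
  ultimately show ?thesis using that by (simp add: R_def)
qed

text \<open>
  The distance before it is truncated to a real number; bounds can be proved for it without showing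
  first that some curve has finite length.
\<close>

definition ext_dist :: "'v \<Rightarrow> 'v \<Rightarrow> ennreal" where
  "ext_dist p q = (INF (a, b, c)\<in>curves ip S e p q. curve_length ip S T a b c)"

lemma dist_from_e:
  assumes "q \<in> sheet"
  shows "ext_dist e q = ennreal (arcosh (height q))"
proof (rule antisym)
  obtain c where c: "(0, 1, c) \<in> curves ip S e e q"
    "curve_length ip S T 0 1 c = ennreal (arcosh (height q))"
    using hyperbola_to_point[OF assms] .
  show "ext_dist e q \<le> ennreal (arcosh (height q))"
    unfolding ext_dist_def by (rule INF_lower2[OF c(1)]) (simp add: c(2))
  show "ennreal (arcosh (height q)) \<le> ext_dist e q"
    unfolding ext_dist_def using arcosh_height_le_curve_length by (intro INF_greatest) auto
qed

section \<open>Transport by isometries\<close>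

lemma isometry_curve_length:
  assumes F: "linear F" "\<And>v w. mink_prod ip S T (F v) (F w) = mink_prod ip S T v w"
      "F ` sheet \<subseteq> sheet"
    and c: "(a, b, c) \<in> curves ip S e p q"
  shows "(a, b, F \<circ> c) \<in> curves ip S e (F p) (F q)"
    and "curve_length ip S T a b (F \<circ> c) = curve_length ip S T a b c"
proof -
  from c have ab: "a < b" and sub: "c ` {a..b} \<subseteq> sheet" and ends: "c a = p" "c b = q"
    and pd: "c piecewise_differentiable_on {a..b}"
    by (auto simp: curves_def)
  obtain K where cont: "continuous_on {a..b} c" and K: "finite K"
    and diff: "\<And>x. x \<in> {a..b} - K \<Longrightarrow> c differentiable (at x within {a..b})"
    using pd unfolding piecewise_differentiable_on_def by blast
  have F': "((F \<circ> c) has_vector_derivative F v) (at x within A)"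
    if "(c has_vector_derivative v) (at x within A)" for v x A
    unfolding o_def
    using bounded_linear.has_vector_derivative[OF linear_conv_bounded_linear[THEN iffD1, OF F(1)] that] .
  have "(F \<circ> c) piecewise_differentiable_on {a..b}"
    unfolding piecewise_differentiable_on_def
  proof (intro conjI exI ballI)
    show "continuous_on {a..b} (F \<circ> c)"
      unfolding o_def by (rule linear_continuous_on_compose[OF cont F(1)])
    show "finite K" by fact
    show "(F \<circ> c) differentiable (at x within {a..b})" if "x \<in> {a..b} - K" for x
      using F' diff[OF that] vector_derivative_works differentiableI_vector by blast
  qed
  then show "(a, b, F \<circ> c) \<in> curves ip S e (F p) (F q)"
    using ab sub ends F(3) by (auto simp: curves_def)
  have deriv: "vector_derivative (F \<circ> c) (at x within {a..b}) =
      F (vector_derivative c (at x within {a..b}))" if "x \<in> {a..b} - K" for x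
  proof -
    have "(c has_vector_derivative vector_derivative c (at x within {a..b})) (at x within {a..b})"
      using diff[OF that] by (simp add: vector_derivative_works)
    then show ?thesis
      using that by (intro vector_derivative_within_closed_interval[OF ab _ F']) simp_all
  qed
  have "AE x in lborel. x \<notin> K"
    using K by (intro AE_not_in finite_imp_null_set_lborel)
  then show "curve_length ip S T a b (F \<circ> c) = curve_length ip S T a b c"
    unfolding curve_length_def
    by (intro nn_integral_cong_AE) (auto simp: indicator_def deriv F(2))
qed

lemma isometry_dist_le:
  assumes "linear F" "\<And>v w. mink_prod ip S T (F v) (F w) = mink_prod ip S T v w"
      "F ` sheet \<subseteq> sheet"
  shows "ext_dist (F p) (F q) \<le> ext_dist p q"
  unfolding ext_dist_def
proof (rule INF_greatest, clarify)
  fix a b c assume c: "(a, b, c) \<in> curves ip S e p q"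
  note Fc = isometry_curve_length[OF assms c]
  show "(INF (a, b, c)\<in>curves ip S e (F p) (F q). curve_length ip S T a b c)
      \<le> curve_length ip S T a b c"
    by (rule INF_lower2[OF Fc(1)]) (simp add: Fc(2))
qed

lemma transitive_isometry:
  assumes "acts_transitively (linear_isometries ip S T e) sheet" "p \<in> sheet" "q \<in> sheet"
  obtains F where "linear F" "\<And>v w. mink_prod ip S T (F v) (F w) = mink_prod ip S T v w"
      "F ` sheet = sheet" "F p = q"
proof -
  obtain g where g: "g \<in> linear_isometries ip S T e" "g p = q"
    using assms unfolding acts_transitively_def by blast
  then obtain F where "g = restrict F sheet" "linear F"
    "\<And>v w. mink_prod ip S T (F v) (F w) = mink_prod ip S T v w" "F ` sheet = sheet"
    unfolding linear_isometries_def by blast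
  with g(2) assms(2) that show ?thesis by auto
qed

text \<open>
  Using one isometry in each direction avoids showing that the inverse of an isometry is an isometry:
  the points \<open>F b\<close> and \<open>b'\<close> may differ, but both have height \<open>- [a,b]\<^sup>+\<close>, and so the same distance
  from \<open>e\<close>.
\<close>

lemma dist_eq_arcosh:
  assumes trans: "acts_transitively (linear_isometries ip S T e) sheet"
    and a: "a \<in> sheet" and b: "b \<in> sheet"
  shows "1 \<le> - mink_prod ip S T a b"
    and "ext_dist a b = ennreal (arcosh (- mink_prod ip S T a b))"
proof -
  obtain F where F: "linear F" "\<And>v w. mink_prod ip S T (F v) (F w) = mink_prod ip S T v w"
      "F ` sheet = sheet" "F a = e"
    using transitive_isometry[OF trans a e_in_sheet] by blast
  obtain G where G: "linear G" "\<And>v w. mink_prod ip S T (G v) (G w) = mink_prod ip S T v w"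
      "G ` sheet = sheet" "G e = a"
    using transitive_isometry[OF trans e_in_sheet a] by blast
  obtain b' where b': "b' \<in> sheet" "b = G b'" using G(3) b by auto
  have Fb: "F b \<in> sheet" using F(3) b by auto
  have hF: "height (F b) = - mink_prod ip S T a b"
    using F(2)[of a b] by (simp add: F(4) mink_prod_e_left)
  have hG: "height b' = - mink_prod ip S T a b"
    using G(2)[of e b'] by (simp add: G(4) b'(2) mink_prod_e_left)
  show "1 \<le> - mink_prod ip S T a b"
    using sheet_height_ge_1[OF Fb] hF by simp
  show "ext_dist a b = ennreal (arcosh (- mink_prod ip S T a b))"
  proof (rule antisym)
    have "ext_dist (G e) (G b') \<le> ext_dist e b'"
      using G by (intro isometry_dist_le) auto
    then show "ext_dist a b \<le> ennreal (arcosh (- mink_prod ip S T a b))"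
      using dist_from_e[OF b'(1)] hG by (simp add: G(4) b'(2))
    have "ext_dist (F a) (F b) \<le> ext_dist a b"
      using F by (intro isometry_dist_le) auto
    then show "ennreal (arcosh (- mink_prod ip S T a b)) \<le> ext_dist a b"
      using dist_from_e[OF Fb] hF by (simp add: F(4))
  qed
qed

end

theorem theorem15:
  fixes ip :: "'v::euclidean_space \<Rightarrow> 'v \<Rightarrow> real" and S T :: "'v set" and e :: 'v
  assumes "spacetime_model ip S T"
    and "e \<in> T" and "ip e e = -1"
    and "strictly_convex_space ip S"
    and "smooth_space ip S"
    and "continuously_differentiable_sip ip S"
    and "acts_transitively (linear_isometries ip S T e) (upper_sheet ip S e)"
  shows "\<forall>a\<in>upper_sheet ip S e. \<forall>b\<in>upper_sheet ip S e.
    mink_prod ip S T a b = - cosh (mf_dist ip S T e a b)"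
proof (intro ballI)
  fix a b assume a: "a \<in> upper_sheet ip S e" and b: "b \<in> upper_sheet ip S e"
  interpret minkowski_model ip S T e
    using assms(1-3) by unfold_locales
  note d = dist_eq_arcosh[OF assms(7) a b]
  have "mf_dist ip S T e a b = enn2real (ext_dist a b)"
    by (simp add: mf_dist_def ext_dist_def)
  also have "\<dots> = arcosh (- mink_prod ip S T a b)"
    unfolding d(2) by (rule enn2real_ennreal[OF arcosh_nonneg_real[OF d(1)]])
  finally show "mink_prod ip S T a b = - cosh (mf_dist ip S T e a b)"
    using cosh_arcosh_real[OF d(1)] by simp
qed

end
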